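(* Let $n$ be a positive integer and let $\mathcal{F}$ be a family of subsets of $[n]=\{1,\dots,n\}$ that is diamond-free, i.e. there do not exist four distinct sets $A,B,C,D\in\mathcal{F}$ with $A\subset B\subset D$ and $A\subset C\subset D$ (the sets $B$ and $C$ may or may not be comparable). Then $$|\mathcal{F}|\le (2.25+o(1))\binom{n}{\lfloor n/2\rfloor},$$ where $o(1)$ denotes a quantity depending only on $n$ that tends to $0$ as $n\to\infty$ (uniformly over all such families $\mathcal{F}$).
   Context: The $n$-dimensional Boolean lattice $\mathcal{B}_n$ is the poset $(2^{[n]},\subseteq)$. The diamond $\mathcal{B}_2$ is the poset on four elements $A<B,C<D$; a family is diamond-free if it contains no (weak) copy of this poset, as spelled out in the claim. *)

theory Defs
  imports Complex_Main
begin

definition diamond_free :: "'a set set \<Rightarrow> bool" where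
  "diamond_free F \<longleftrightarrow>
     \<not> (\<exists>A\<in>F. \<exists>B\<in>F. \<exists>C\<in>F. \<exists>D\<in>F.
          distinct [A, B, C, D] \<and> A \<subset> B \<and> B \<subset> D \<and> A \<subset> C \<and> C \<subset> D)"

end

theory Submission
  imports Defs "HOL-Real_Asymp.Real_Asymp"
begin

text \<open>
  The Lubell function \<open>lubell S G\<close> is the expected number of members of \<open>G\<close> on a random maximal
  chain of subsets of \<open>S\<close>. Discard the members of the diamond-free family having fewer than \<open>t\<close>
  elements (a negligible number) and split the chains according to their largest member \<open>S\<close>.
  The complements in \<open>S\<close> of the other members below \<open>S\<close> form a family \<open>G\<close> of nonempty sets each of
  which properly contains at most one other member, and it suffices to show that the Lubell function
  of such a \<open>G\<close> is at most \<open>5/4 + o(1)\<close>.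

  A chain meets \<open>G\<close> at most twice, and a member with at least five elements is met together with
  the one it contains by at most a fifth of the chains through it. Hence \<open>lubell S G\<close> is at most the
  average, over the \<open>4\<close>-subsets \<open>H\<close> of \<open>S\<close>, of \<open>lubell H G\<close> if \<open>H\<close> contains two members, and of \<open>6/5\<close>
  otherwise. Colour a pair of points red or blue according to the members it contains. In each \<open>H\<close>
  the quantity averaged is at most \<open>5/4 - q(H)/24\<close>, where \<open>q(H)\<close> sums, over the pairs \<open>v, w\<close> in \<open>H\<close>
  with remaining points \<open>z, z'\<close>, the product of signs \<open>s(z) s(z')\<close>; the sign compares the colours of
  \<open>vz\<close> and \<open>wz\<close>. Summed over all \<open>H\<close>, the form \<open>q\<close> is a sum of squares up to diagonal terms, so its
  average is at least \<open>-O(1/|S|)\<close>.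
\<close>

section \<open>The Lubell function\<close>

text \<open>Members outside \<open>S\<close> are filtered out, so one fixed \<open>G\<close> can be
  evaluated on smaller and smaller \<open>S\<close> in the inductions.\<close>

definition lubell :: "'a set \<Rightarrow> 'a set set \<Rightarrow> real" where
  "lubell S G = (\<Sum>D\<in>{D \<in> G. D \<subseteq> S}. 1 / real (card S choose card D))"

definition contains_at_most_one :: "'a set set \<Rightarrow> bool" where
  "contains_at_most_one G \<longleftrightarrow>
     (\<forall>D\<in>G. \<forall>E\<in>G. \<forall>E'\<in>G. E \<subset> D \<longrightarrow> E' \<subset> D \<longrightarrow> E = E')"

lemma finite_subfamily: "finite S \<Longrightarrow> finite {D \<in> G. D \<subseteq> S}"
  by (rule finite_subset[of _ "Pow S"]) auto

lemma choose_ratio: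
  assumes "k < n"
  shows "real (n - k) / real (n - 1 choose k) = real n / real (n choose k)"
proof -
  have "(n - k) * (n choose k) = n * (n - 1 choose k)"
    using assms binomial_absorb_comp by simp
  then have "real (n - k) * real (n choose k) = real n * real (n - 1 choose k)"
    by (metis of_nat_mult)
  moreover have "0 < n choose k" "0 < n - 1 choose k"
    using assms by (auto simp: zero_less_binomial_iff)
  ultimately show ?thesis by (simp add: field_simps)
qed

lemma lubell_insert_self:
  assumes "finite S"
  shows "lubell S G = of_bool (S \<in> G) + (\<Sum>D\<in>{D \<in> G. D \<subset> S}. 1 / real (card S choose card D))"
proof -
  have fin: "finite {D \<in> G. D \<subset> S}"
    by (rule finite_subset[OF _ finite_subfamily[OF assms, of G]]) auto
  show ?thesis
  proof (cases "S \<in> G")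
    case True
    then have "{D \<in> G. D \<subseteq> S} = insert S {D \<in> G. D \<subset> S}" by auto
    then show ?thesis using fin True by (simp add: lubell_def)
  next
    case False
    then have "{D \<in> G. D \<subseteq> S} = {D \<in> G. D \<subset> S}" by auto
    then show ?thesis using False by (simp add: lubell_def)
  qed
qed

text \<open>Below \<open>S\<close> a random maximal chain passes through \<open>S - {x}\<close> with
  \<open>x\<close> uniform, so the expectation is the average over these sets, plus 1 if
  \<open>S\<close> is a member. The formal proof is a double count: a proper subset \<open>D\<close>
  of \<open>S\<close> survives the deletion of \<open>card S - card D\<close> points.\<close>

lemma lubell_rec:
  assumes "finite S"
  shows "real (card S) * lubell S G
    = real (card S) * of_bool (S \<in> G) + (\<Sum>x\<in>S. lubell (S - {x}) G)"
proof -
  have fin: "finite {D \<in> G. D \<subset> S}"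
    by (rule finite_subset[OF _ finite_subfamily[OF assms, of G]]) auto
  have "(\<Sum>x\<in>S. lubell (S - {x}) G)
      = (\<Sum>x\<in>S. \<Sum>D\<in>{D \<in> G. D \<subset> S}. of_bool (x \<notin> D) / real (card S - 1 choose card D))"
  proof (rule sum.cong[OF refl])
    fix x assume x: "x \<in> S"
    have "{D \<in> G. D \<subseteq> S - {x}} = {D \<in> {D \<in> G. D \<subset> S}. x \<notin> D}" using x by auto
    then have "lubell (S - {x}) G
        = (\<Sum>D\<in>{D \<in> {D \<in> G. D \<subset> S}. x \<notin> D}. 1 / real (card S - 1 choose card D))"
      using x assms by (simp add: lubell_def)
    also have "\<dots> = (\<Sum>D\<in>{D \<in> G. D \<subset> S}. if x \<notin> D then 1 / real (card S - 1 choose card D) else 0)"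
      using fin by (rule sum.inter_filter)
    also have "\<dots> = (\<Sum>D\<in>{D \<in> G. D \<subset> S}. of_bool (x \<notin> D) / real (card S - 1 choose card D))"
      by (rule sum.cong) auto
    finally show "lubell (S - {x}) G = \<dots>" .
  qed
  also have "\<dots> = (\<Sum>D\<in>{D \<in> G. D \<subset> S}. \<Sum>x\<in>S. of_bool (x \<notin> D) / real (card S - 1 choose card D))"
    by (rule sum.swap)
  also have "\<dots> = (\<Sum>D\<in>{D \<in> G. D \<subset> S}. real (card S) * (1 / real (card S choose card D)))"
  proof (rule sum.cong[OF refl])
    fix D assume "D \<in> {D \<in> G. D \<subset> S}"
    then have D: "D \<subset> S" by simp
    have "(\<Sum>x\<in>S. of_bool (x \<notin> D)) = real (card (S - D))"
      using assms by (simp add: Diff_eq Collect_neg_eq sum.If_cases of_bool_def)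
    also have "card (S - D) = card S - card D"
      using D assms by (meson card_Diff_subset finite_subset psubset_imp_subset)
    finally have "(\<Sum>x\<in>S. of_bool (x \<notin> D) / real (card S - 1 choose card D))
        = real (card S - card D) / real (card S - 1 choose card D)"
      by (simp flip: sum_divide_distrib)
    then show "(\<Sum>x\<in>S. of_bool (x \<notin> D) / real (card S - 1 choose card D))
        = real (card S) * (1 / real (card S choose card D))"
      using choose_ratio[OF psubset_card_mono[OF assms D]] by simp
  qed
  finally show ?thesis
    by (simp add: lubell_insert_self[OF assms] distrib_left sum_distrib_left)
qed

text \<open>Complementation reverses maximal chains; numerically this is the symmetry of the
  binomial coefficients.\<close>

lemma lubell_complement:
  assumes "finite S" and "G \<subseteq> Pow S"
  shows "lubell S ((\<lambda>D. S - D) ` G) = lubell S G"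
proof -
  have inj: "inj_on (\<lambda>D. S - D) G"
    using assms(2) by (intro inj_onI) blast
  have "{D \<in> (\<lambda>D. S - D) ` G. D \<subseteq> S} = (\<lambda>D. S - D) ` G" "{D \<in> G. D \<subseteq> S} = G"
    using assms(2) by auto
  then have "lubell S ((\<lambda>D. S - D) ` G) = (\<Sum>D\<in>G. 1 / real (card S choose card (S - D)))"
    by (simp add: lubell_def sum.reindex[OF inj])
  also have "\<dots> = (\<Sum>D\<in>G. 1 / real (card S choose card D))"
  proof (rule sum.cong[OF refl])
    fix D assume "D \<in> G"
    then have "D \<subseteq> S" using assms(2) by auto
    then have "card (S - D) = card S - card D" "card D \<le> card S"
      using assms(1) by (auto simp: card_Diff_subset finite_subset card_mono)
    then show "1 / real (card S choose card (S - D)) = 1 / real (card S choose card D)"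
      using binomial_symmetric[of "card D" "card S"] by simp
  qed
  finally show ?thesis using \<open>{D \<in> G. D \<subseteq> S} = G\<close> by (simp add: lubell_def)
qed

lemma choose_ge_self: "0 < k \<Longrightarrow> k < n \<Longrightarrow> n \<le> n choose k"
proof (induction n arbitrary: k)
  case (Suc n)
  then obtain j where k: "k = Suc j" by (cases k) auto
  show ?case
  proof (cases "k = n")
    case False
    with Suc have "n \<le> n choose k" by simp
    moreover have "0 < n choose j" using Suc.prems k by (simp add: zero_less_binomial_iff)
    ultimately show ?thesis unfolding k binomial_Suc_Suc by linarith
  qed simp
qed simp

section \<open>Averaging over four-element subsets\<close>

text \<open>Ordered quadruples list every 4-subset 24 times. The ordering lets sums be nested point
  by point and lets coordinates be permuted.\<close>

definition distinct_quads :: "'a set \<Rightarrow> ('a \<times> 'a \<times> 'a \<times> 'a) set" where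
  "distinct_quads S = {(a, b, c, d). {a, b, c, d} \<subseteq> S \<and> distinct [a, b, c, d]}"

lemma distinct_quads_Sigma:
  "distinct_quads S = (SIGMA a:S. SIGMA b:S - {a}. SIGMA c:S - {a, b}. S - {a, b, c})"
  by (auto simp: distinct_quads_def)

lemma finite_distinct_quads: "finite S \<Longrightarrow> finite (distinct_quads S)"
  by (simp add: distinct_quads_Sigma)

lemma sum_distinct_quads:
  assumes "finite S"
  shows "(\<Sum>(a, b, c, d)\<in>distinct_quads S. f a b c d)
    = (\<Sum>a\<in>S. \<Sum>b\<in>S - {a}. \<Sum>c\<in>S - {a, b}. \<Sum>d\<in>S - {a, b, c}. f a b c d)"
  using assms by (simp add: distinct_quads_Sigma sum.Sigma split_def)

lemma card_distinct_quads:
  assumes "finite S"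
  shows "card (distinct_quads S) = card S * ((card S - 1) * ((card S - 2) * (card S - 3)))"
proof -
  have "card (distinct_quads S) = (\<Sum>(a, b, c, d)\<in>distinct_quads S. 1)"
    by (simp add: split_def)
  also have "\<dots> = (\<Sum>a\<in>S. \<Sum>b\<in>S - {a}. \<Sum>c\<in>S - {a, b}. \<Sum>d\<in>S - {a, b, c}. 1)"
    by (rule sum_distinct_quads[OF assms])
  also have "\<dots> = (\<Sum>a\<in>S. \<Sum>b\<in>S - {a}. \<Sum>c\<in>S - {a, b}. card S - 3)"
  proof (intro sum.cong refl)
    fix a b c assume "a \<in> S" "b \<in> S - {a}" "c \<in> S - {a, b}"
    then have "card (S - {a, b, c}) = card S - card {a, b, c}" "card {a, b, c} = 3"
      by (auto simp: card_Diff_subset)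
    then show "(\<Sum>d\<in>S - {a, b, c}. 1) = card S - 3" by simp
  qed
  also have "\<dots> = (\<Sum>a\<in>S. \<Sum>b\<in>S - {a}. (card S - 2) * (card S - 3))"
  proof (intro sum.cong refl)
    fix a b assume "a \<in> S" "b \<in> S - {a}"
    then have "card (S - {a, b}) = card S - card {a, b}" "card {a, b} = 2"
      by (auto simp: card_Diff_subset)
    then show "(\<Sum>c\<in>S - {a, b}. card S - 3) = (card S - 2) * (card S - 3)" by simp
  qed
  also have "\<dots> = card S * ((card S - 1) * ((card S - 2) * (card S - 3)))"
    using assms by simp
  finally show ?thesis .
qed

definition capped_lubell :: "'a set set \<Rightarrow> 'a set \<Rightarrow> real" where
  "capped_lubell G H =
     (if \<exists>D\<in>G. \<exists>E\<in>G. D \<noteq> E \<and> D \<subseteq> H \<and> E \<subseteq> H then lubell H G else 6/5)"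

text \<open>A quadruple survives the deletion of \<open>x\<close> exactly when \<open>x\<close> is
  one of the \<open>card S - 4\<close> points outside it. If \<open>card S < 4\<close> there are no
  quadruples and both sides vanish.\<close>

lemma sum_over_deletions:
  fixes f :: "'a \<times> 'a \<times> 'a \<times> 'a \<Rightarrow> real"
  assumes "finite S"
  shows "(\<Sum>x\<in>S. \<Sum>t\<in>distinct_quads (S - {x}). f t)
    = real (card S - 4) * (\<Sum>t\<in>distinct_quads S. f t)"
proof -
  let ?Q = "distinct_quads S" and ?s = "\<lambda>(a, b, c, d). {a, b, c, d}"
  have "(\<Sum>x\<in>S. \<Sum>t\<in>distinct_quads (S - {x}). f t) = (\<Sum>x\<in>S. \<Sum>t\<in>?Q. if x \<notin> ?s t then f t else 0)"
  proof (rule sum.cong[OF refl])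
    fix x assume "x \<in> S"
    then have "distinct_quads (S - {x}) = {t \<in> ?Q. x \<notin> ?s t}"
      by (auto simp: distinct_quads_def)
    then show "(\<Sum>t\<in>distinct_quads (S - {x}). f t) = (\<Sum>t\<in>?Q. if x \<notin> ?s t then f t else 0)"
      using sum.inter_filter[OF finite_distinct_quads[OF assms]] by simp
  qed
  also have "\<dots> = (\<Sum>t\<in>?Q. \<Sum>x\<in>S. if x \<notin> ?s t then f t else 0)"
    by (rule sum.swap)
  also have "\<dots> = (\<Sum>t\<in>?Q. real (card S - 4) * f t)"
  proof (rule sum.cong[OF refl])
    fix t assume t: "t \<in> ?Q"
    then have "?s t \<subseteq> S" "card (?s t) = 4" by (auto simp: distinct_quads_def)
    then have "card (S - ?s t) = card S - 4"
      using card_Diff_subset[of "?s t" S] assms finite_subset by metis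
    moreover have "{x \<in> S. x \<notin> ?s t} = S - ?s t" by auto
    ultimately show "(\<Sum>x\<in>S. if x \<notin> ?s t then f t else 0) = real (card S - 4) * f t"
      using sum.inter_filter[OF assms, of "\<lambda>_. f t" "\<lambda>x. x \<notin> ?s t"] by simp
  qed
  finally show ?thesis by (simp add: sum_distrib_left)
qed

text \<open>
  The cap \<open>6/5\<close> is needed in the induction step when \<open>S\<close> itself is a member: then every \<open>4\<close>-subset of \<open>S\<close>
  contains at most one member, and \<open>lubell S G\<close> is at most \<open>1 + 1/|S|\<close>.
\<close>
lemma lubell_le_average_capped:
  assumes "finite S" and "4 \<le> card S" and "{} \<notin> G" and G: "contains_at_most_one G"
  shows "lubell S G * real (card (distinct_quads S))
    \<le> (\<Sum>(a, b, c, d)\<in>distinct_quads S. capped_lubell G {a, b, c, d})"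
  using assms(1,2)
proof (induction "card S" arbitrary: S rule: less_induct)
  case less
  let ?J = "\<lambda>(a, b, c, d). capped_lubell G {a, b, c, d}"
  have const: "lubell S G * real (card (distinct_quads S)) \<le> (\<Sum>t\<in>distinct_quads S. ?J t)"
    if "\<And>a b c d. (a, b, c, d) \<in> distinct_quads S \<Longrightarrow> lubell S G \<le> capped_lubell G {a, b, c, d}"
    using sum_bounded_below[of "distinct_quads S" "lubell S G" ?J] that
    by (force simp: mult.commute)
  have fin: "finite {D \<in> G. D \<subset> S}"
    by (rule finite_subset[OF _ finite_subfamily[OF less.prems(1), of G]]) auto
  consider "card S = 4" | "4 < card S" "S \<in> G" | "4 < card S" "S \<notin> G"
    using less.prems by linarith
  then show ?case
  proof cases
    case 1
    have "lubell S G \<le> capped_lubell G S"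
    proof (cases "\<exists>D\<in>G. \<exists>E\<in>G. D \<noteq> E \<and> D \<subseteq> S \<and> E \<subseteq> S")
      case False
      then have "card {D \<in> G. D \<subseteq> S} \<le> 1"
        using finite_subfamily[OF less.prems(1), of G] by (auto simp: card_le_Suc0_iff_eq)
      moreover have "lubell S G \<le> (\<Sum>D\<in>{D \<in> G. D \<subseteq> S}. 1)"
        unfolding lubell_def
      proof (rule sum_mono)
        fix D assume "D \<in> {D \<in> G. D \<subseteq> S}"
        then have "card D \<le> card S" using less.prems(1) card_mono by auto
        then have "1 \<le> card S choose card D" by (simp add: Suc_leI zero_less_binomial_iff)
        then show "1 / real (card S choose card D) \<le> 1" by (auto simp: divide_le_eq_1)
      qed
      ultimately have "lubell S G \<le> 1" by simp
      with False show ?thesis by (simp add: capped_lubell_def)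
    qed (simp add: capped_lubell_def)
    moreover have "{a, b, c, d} = S" if "(a, b, c, d) \<in> distinct_quads S" for a b c d
      using that 1 less.prems(1) by (intro card_subset_eq) (auto simp: distinct_quads_def)
    ultimately show ?thesis by (intro const) simp
  next
    case 2
    have "card {D \<in> G. D \<subset> S} \<le> 1"
      using fin G 2(2) unfolding contains_at_most_one_def
      by (auto simp: card_le_Suc0_iff_eq)
    moreover have "(\<Sum>D\<in>{D \<in> G. D \<subset> S}. 1 / real (card S choose card D)) \<le> real (card {D \<in> G. D \<subset> S}) * (1 / 5)"
    proof (rule sum_bounded_above)
      fix D assume D: "D \<in> {D \<in> G. D \<subset> S}"
      then have "finite D" using less.prems(1) finite_subset by blast
      then have "0 < card D" using D assms(3) by (auto simp: card_gt_0_iff)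
      moreover have "card D < card S" using D less.prems(1) by (simp add: psubset_card_mono)
      ultimately have "5 \<le> card S choose card D" using choose_ge_self[of "card D" "card S"] 2(1) by linarith
      then show "1 / real (card S choose card D) \<le> 1 / 5" by (auto simp: divide_simps)
    qed
    ultimately have "lubell S G \<le> 6/5"
      using 2(2) by (simp add: lubell_insert_self[OF less.prems(1)])
    moreover have "capped_lubell G {a, b, c, d} = 6/5" if q: "(a, b, c, d) \<in> distinct_quads S" for a b c d
    proof -
      have "card {a, b, c, d} = 4" "{a, b, c, d} \<subseteq> S" using q by (auto simp: distinct_quads_def)
      then have "{a, b, c, d} \<subset> S" using 2(1) by (metis nat_less_le psubsetI)
      then have "\<not> (\<exists>D\<in>G. \<exists>E\<in>G. D \<noteq> E \<and> D \<subseteq> {a, b, c, d} \<and> E \<subseteq> {a, b, c, d})"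
        using G 2(2) unfolding contains_at_most_one_def by (meson subset_psubset_trans)
      then show ?thesis unfolding capped_lubell_def by (rule if_not_P)
    qed
    ultimately show ?thesis by (intro const) (simp only:)
  next
    case 3
    let ?n = "real (card S)"
    have cS: "real (card (distinct_quads S)) = ?n * ((?n - 1) * ((?n - 2) * (?n - 3)))"
      using 3 less.prems(1) by (simp add: card_distinct_quads of_nat_diff)
    have cx: "real (card (distinct_quads (S - {x}))) = (?n - 1) * ((?n - 2) * ((?n - 3) * (?n - 4)))"
      if "x \<in> S" for x
      using 3 less.prems(1) that by (simp add: card_distinct_quads of_nat_diff)
    \<comment> \<open>\<open>n - 4\<close> times the number of quadruples in \<open>S\<close> is
      \<open>n\<close> times the number in \<open>S - {x}\<close>. The recursion and the double
      count thus share the positive factor \<open>n - 4\<close>, which cancels.\<close>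
    have "(?n - 4) * (lubell S G * real (card (distinct_quads S)))
        = (?n * lubell S G) * ((?n - 1) * ((?n - 2) * ((?n - 3) * (?n - 4))))"
      unfolding cS by (simp only: mult_ac)
    also have "\<dots> = (\<Sum>x\<in>S. lubell (S - {x}) G * real (card (distinct_quads (S - {x}))))"
      using 3(2) cx by (simp add: lubell_rec[OF less.prems(1)] sum_distrib_right)
    also have "\<dots> \<le> (\<Sum>x\<in>S. \<Sum>t\<in>distinct_quads (S - {x}). ?J t)"
      using 3 less.prems(1) by (intro sum_mono less.hyps) (auto simp: card_Diff1_less)
    also have "\<dots> = (?n - 4) * (\<Sum>t\<in>distinct_quads S. ?J t)"
      using 3 by (simp add: sum_over_deletions[OF less.prems(1)] of_nat_diff)
    finally show ?thesis using 3 by simp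
  qed
qed

section \<open>The quadratic form\<close>

text \<open>
  Here \<open>u\<close>, \<open>v\<close> say whether the two singletons belong to the family, and \<open>p\<close> whether the pair does.
  The value of \<open>pair_sign r a b\<close> is the sign of \<open>z\<close> with respect to \<open>v, w\<close>, where \<open>r\<close>, \<open>a\<close>, \<open>b\<close> tell
  which of \<open>vw\<close>, \<open>vz\<close>, \<open>wz\<close> are red. The signs are balanced in the extremal configurations, e.g. when
  the red graph is the union of two disjoint cliques of equal size.
\<close>
definition red_pair :: "bool \<Rightarrow> bool \<Rightarrow> bool \<Rightarrow> bool" where
  "red_pair u v p \<longleftrightarrow> (u \<and> v) \<or> (p \<longleftrightarrow> (u \<longleftrightarrow> v))"

definition pair_sign :: "bool \<Rightarrow> bool \<Rightarrow> bool \<Rightarrow> int" where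
  "pair_sign r a b = (if r then of_bool a + of_bool b - 1 else of_bool a - of_bool b)"

definition quad_form :: "bool \<Rightarrow> bool \<Rightarrow> bool \<Rightarrow> bool \<Rightarrow> bool \<Rightarrow> bool \<Rightarrow> int" where
  "quad_form r12 r13 r14 r23 r24 r34 =
     pair_sign r12 r13 r23 * pair_sign r12 r14 r24 + pair_sign r13 r12 r23 * pair_sign r13 r14 r34
     + pair_sign r14 r12 r24 * pair_sign r14 r13 r34 + pair_sign r23 r12 r13 * pair_sign r23 r24 r34
     + pair_sign r24 r12 r14 * pair_sign r24 r23 r34 + pair_sign r34 r13 r14 * pair_sign r34 r23 r24"

text \<open>Indicates that the triple may belong to the family, given the smaller members inside it.\<close>
definition triple_room :: "bool \<Rightarrow> bool \<Rightarrow> bool \<Rightarrow> bool \<Rightarrow> bool \<Rightarrow> bool \<Rightarrow> int" where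
  "triple_room u1 u2 u3 p12 p13 p23 =
     of_bool (of_bool u1 + of_bool u2 + of_bool u3 + of_bool p12 + of_bool p13 + of_bool p23 \<le> (1::int))"

text \<open>The first conjunct is 24 times the bound \<open>5/4 - q/24\<close> for a 4-set that is
  not a member, with every triple that has room counted as present: a \<open>k\<close>-set has
  weight \<open>24 / (4 choose k)\<close>. The second conjunct serves 4-sets that are members or
  contain at most one member.\<close>

definition quad_ineq ::
  "bool \<Rightarrow> bool \<Rightarrow> bool \<Rightarrow> bool \<Rightarrow> bool \<Rightarrow> bool \<Rightarrow> bool \<Rightarrow> bool \<Rightarrow> bool \<Rightarrow> bool \<Rightarrow> bool" where
  "quad_ineq u1 u2 u3 u4 p12 p13 p14 p23 p24 p34 \<longleftrightarrow>
    (let su = of_bool u1 + of_bool u2 + of_bool u3 + of_bool u4;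
         sp = of_bool p12 + of_bool p13 + of_bool p14 + of_bool p23 + of_bool p24 + of_bool p34;
         q = quad_form (red_pair u1 u2 p12) (red_pair u1 u3 p13) (red_pair u1 u4 p14)
               (red_pair u2 u3 p23) (red_pair u2 u4 p24) (red_pair u3 u4 p34)
     in 6 * su + 4 * sp
          + 6 * (triple_room u1 u2 u3 p12 p13 p23 + triple_room u1 u2 u4 p12 p14 p24
            + triple_room u1 u3 u4 p13 p14 p34 + triple_room u2 u3 u4 p23 p24 p34)
          + q \<le> 30 \<and>
        (su + sp \<le> 1 \<longrightarrow> q \<le> sp))"

lemma quad_ineq_holds:
  assumes "p12 \<longrightarrow> \<not> (u1 \<and> u2)" "p13 \<longrightarrow> \<not> (u1 \<and> u3)" "p14 \<longrightarrow> \<not> (u1 \<and> u4)"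
    "p23 \<longrightarrow> \<not> (u2 \<and> u3)" "p24 \<longrightarrow> \<not> (u2 \<and> u4)" "p34 \<longrightarrow> \<not> (u3 \<and> u4)"
  shows "quad_ineq u1 u2 u3 u4 p12 p13 p14 p23 p24 p34"
  using assms
  \<comment> \<open>A finite check. Fixing the singletons first lets the hypotheses rule out pairs,
    which reduces the number of cases.\<close>
  by (cases u1; cases u2; cases u3; cases u4; simp)
    (cases p12; cases p13; cases p14; cases p23; cases p24; cases p34;
      simp add: quad_ineq_def quad_form_def pair_sign_def red_pair_def triple_room_def)+

definition red_edge :: "'a set set \<Rightarrow> 'a \<Rightarrow> 'a \<Rightarrow> bool" where
  "red_edge G x y = red_pair ({x} \<in> G) ({y} \<in> G) ({x, y} \<in> G)"

lemma red_edge_commute: "red_edge G x y = red_edge G y x"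
  by (auto simp: red_edge_def red_pair_def insert_commute)

definition edge_sign :: "'a set set \<Rightarrow> 'a \<Rightarrow> 'a \<Rightarrow> 'a \<Rightarrow> int" where
  "edge_sign G v w z = pair_sign (red_edge G v w) (red_edge G v z) (red_edge G w z)"

text \<open>For fixed \<open>a\<close>, \<open>b\<close> the sum over distinct \<open>c\<close>,
  \<open>d\<close> is the square of the sum of all signs minus the sum of their squares. Signs lie
  in {-1, 0, 1}, so only the diagonal, at most \<open>card S - 2\<close>, is lost.\<close>

lemma sum_sign_products_ge:
  assumes "finite S" and "2 \<le> card S"
  shows "- int (card S * ((card S - 1) * (card S - 2)))
    \<le> (\<Sum>(a, b, c, d)\<in>distinct_quads S. edge_sign G a b c * edge_sign G a b d)"
proof -
  have inner: "- int (card S - 2)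
      \<le> (\<Sum>c\<in>S - {a, b}. \<Sum>d\<in>S - {a, b, c}. edge_sign G a b c * edge_sign G a b d)"
    if ab: "a \<in> S" "b \<in> S - {a}" for a b
  proof -
    let ?P = "S - {a, b}" and ?s = "edge_sign G a b"
    have fin: "finite ?P" using assms(1) by simp
    have cP: "card ?P = card S - 2"
      using ab by (auto simp: card_Diff_subset)
    have "(\<Sum>c\<in>?P. \<Sum>d\<in>S - {a, b, c}. ?s c * ?s d) = (\<Sum>c\<in>?P. ?s c * sum ?s ?P - ?s c * ?s c)"
    proof (rule sum.cong[OF refl])
      fix c assume c: "c \<in> ?P"
      have "S - {a, b, c} = ?P - {c}" by auto
      then show "(\<Sum>d\<in>S - {a, b, c}. ?s c * ?s d) = ?s c * sum ?s ?P - ?s c * ?s c"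
        using fin c by (simp add: sum_diff1 sum_distrib_left)
    qed
    also have "\<dots> = sum ?s ?P * sum ?s ?P - (\<Sum>c\<in>?P. ?s c * ?s c)"
      by (simp add: sum_subtractf sum_distrib_right)
    finally have "(\<Sum>c\<in>?P. \<Sum>d\<in>S - {a, b, c}. ?s c * ?s d)
        = sum ?s ?P * sum ?s ?P - (\<Sum>c\<in>?P. ?s c * ?s c)" .
    moreover have "(\<Sum>c\<in>?P. ?s c * ?s c) \<le> of_nat (card ?P) * 1"
      by (rule sum_bounded_above) (auto simp: edge_sign_def pair_sign_def)
    moreover have "0 \<le> sum ?s ?P * sum ?s ?P" by simp
    ultimately show ?thesis unfolding cP by linarith
  qed
  have "- int (card S * ((card S - 1) * (card S - 2))) = (\<Sum>a\<in>S. \<Sum>b\<in>S - {a}. - int (card S - 2))"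
    using assms by simp algebra
  also have "\<dots> \<le> (\<Sum>a\<in>S. \<Sum>b\<in>S - {a}. \<Sum>c\<in>S - {a, b}. \<Sum>d\<in>S - {a, b, c}. edge_sign G a b c * edge_sign G a b d)"
    by (intro sum_mono inner)
  also have "\<dots> = (\<Sum>(a, b, c, d)\<in>distinct_quads S. edge_sign G a b c * edge_sign G a b d)"
    by (rule sum_distinct_quads[OF assms(1), symmetric])
  finally show ?thesis .
qed

definition edge_form :: "'a set set \<Rightarrow> 'a \<Rightarrow> 'a \<Rightarrow> 'a \<Rightarrow> 'a \<Rightarrow> int" where
  "edge_form G a b c d = quad_form (red_edge G a b) (red_edge G a c) (red_edge G a d) (red_edge G b c) (red_edge G b d) (red_edge G c d)"

lemma edge_form_eq_sum_edge_sign: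
  "edge_form G a b c d = edge_sign G a b c * edge_sign G a b d + edge_sign G a c b * edge_sign G a c d
     + edge_sign G a d b * edge_sign G a d c + edge_sign G b c a * edge_sign G b c d
     + edge_sign G b d a * edge_sign G b d c + edge_sign G c d a * edge_sign G c d b"
  by (simp add: edge_form_def quad_form_def edge_sign_def red_edge_commute[of G b a] red_edge_commute[of G c a]
      red_edge_commute[of G c b] red_edge_commute[of G d a] red_edge_commute[of G d b] red_edge_commute[of G d c])

text \<open>Permuting coordinates maps \<open>distinct_quads S\<close> onto itself and carries each
  of the six products to the first one.\<close>

lemma sum_edge_form:
  "(\<Sum>(a, b, c, d)\<in>distinct_quads S. edge_form G a b c d)
    = 6 * (\<Sum>(a, b, c, d)\<in>distinct_quads S. edge_sign G a b c * edge_sign G a b d)"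
proof -
  let ?f = "\<lambda>a b c d. edge_sign G a b c * edge_sign G a b d"
  let ?Q = "distinct_quads S"
  have "(\<Sum>(a, b, c, d)\<in>?Q. ?f a c b d) = (\<Sum>(a, b, c, d)\<in>?Q. ?f a b c d)"
    by (rule sum.reindex_bij_witness[of _ "\<lambda>(a, b, c, d). (a, c, b, d)" "\<lambda>(a, b, c, d). (a, c, b, d)"])
      (auto simp: distinct_quads_def)
  moreover have "(\<Sum>(a, b, c, d)\<in>?Q. ?f a d b c) = (\<Sum>(a, b, c, d)\<in>?Q. ?f a b c d)"
    by (rule sum.reindex_bij_witness[of _ "\<lambda>(a, b, c, d). (a, c, d, b)" "\<lambda>(a, b, c, d). (a, d, b, c)"])
      (auto simp: distinct_quads_def)
  moreover have "(\<Sum>(a, b, c, d)\<in>?Q. ?f b c a d) = (\<Sum>(a, b, c, d)\<in>?Q. ?f a b c d)"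
    by (rule sum.reindex_bij_witness[of _ "\<lambda>(a, b, c, d). (c, a, b, d)" "\<lambda>(a, b, c, d). (b, c, a, d)"])
      (auto simp: distinct_quads_def)
  moreover have "(\<Sum>(a, b, c, d)\<in>?Q. ?f b d a c) = (\<Sum>(a, b, c, d)\<in>?Q. ?f a b c d)"
    by (rule sum.reindex_bij_witness[of _ "\<lambda>(a, b, c, d). (c, a, d, b)" "\<lambda>(a, b, c, d). (b, d, a, c)"])
      (auto simp: distinct_quads_def)
  moreover have "(\<Sum>(a, b, c, d)\<in>?Q. ?f c d a b) = (\<Sum>(a, b, c, d)\<in>?Q. ?f a b c d)"
    by (rule sum.reindex_bij_witness[of _ "\<lambda>(a, b, c, d). (c, d, a, b)" "\<lambda>(a, b, c, d). (c, d, a, b)"])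
      (auto simp: distinct_quads_def)
  ultimately show ?thesis
    by (simp add: edge_form_eq_sum_edge_sign sum.distrib split_def)
qed

section \<open>Comparison with the quadratic form on four points\<close>

lemma sum_list_of_bool_le_1:
  assumes "distinct L" and "\<And>D E. D \<in> set L \<inter> G \<Longrightarrow> E \<in> set L \<inter> G \<Longrightarrow> D = E"
  shows "(\<Sum>D\<leftarrow>L. of_bool (D \<in> G)) \<le> (1::int)"
proof -
  have "(\<Sum>D\<leftarrow>L. of_bool (D \<in> G)) = (\<Sum>D\<in>set L. of_bool (D \<in> G) :: int)"
    by (rule sum_list_distinct_conv_sum_set[OF assms(1)])
  also have "\<dots> = int (card (set L \<inter> G))"
    by (simp add: Int_def)
  also have "card (set L \<inter> G) \<le> 1"
    using assms(2) by (subst One_nat_def, subst card_le_Suc0_iff_eq) auto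
  finally show ?thesis by simp
qed

text \<open>This and the next three formulas unroll \<open>lubell_rec\<close>. On \<open>m\<close>
  points the factor \<open>m!\<close> clears denominators, giving a \<open>k\<close>-set the weight
  \<open>m! / (m choose k)\<close>.\<close>

lemma lubell_singleton: "{} \<notin> G \<Longrightarrow> lubell {a} G = of_bool ({a} \<in> G)"
proof -
  assume "{} \<notin> G"
  then have "lubell {} G = 0" by (simp add: lubell_def)
  then show ?thesis using lubell_rec[of "{a}" G] by simp
qed

lemma lubell_doubleton:
  assumes "{} \<notin> G" and "a \<noteq> b"
  shows "2 * lubell {a, b} G = 2 * of_bool ({a, b} \<in> G) + of_bool ({a} \<in> G) + of_bool ({b} \<in> G)"
proof -
  have "{a, b} - {a} = {b}" "{a, b} - {b} = {a}" using assms(2) by auto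
  then show ?thesis
    using lubell_rec[of "{a, b}" G] assms by (simp add: lubell_singleton)
qed

lemma lubell_triple:
  assumes "{} \<notin> G" and "distinct [a, b, c]"
  shows "6 * lubell {a, b, c} G = 6 * of_bool ({a, b, c} \<in> G)
    + 2 * (of_bool ({a, b} \<in> G) + of_bool ({a, c} \<in> G) + of_bool ({b, c} \<in> G))
    + 2 * (of_bool ({a} \<in> G) + of_bool ({b} \<in> G) + of_bool ({c} \<in> G))"
proof -
  have "{a, b, c} - {a} = {b, c}" "{a, b, c} - {b} = {a, c}" "{a, b, c} - {c} = {a, b}"
    using assms(2) by auto
  then show ?thesis
    using lubell_rec[of "{a, b, c}" G] assms
      lubell_doubleton[of G a b] lubell_doubleton[of G a c] lubell_doubleton[of G b c] by simp
qed

lemma lubell_quadruple: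
  assumes "{} \<notin> G" and "distinct [a, b, c, d]"
  shows "24 * lubell {a, b, c, d} G = 24 * of_bool ({a, b, c, d} \<in> G)
    + 6 * (of_bool ({a, b, c} \<in> G) + of_bool ({a, b, d} \<in> G)
         + of_bool ({a, c, d} \<in> G) + of_bool ({b, c, d} \<in> G))
    + 4 * (of_bool ({a, b} \<in> G) + of_bool ({a, c} \<in> G) + of_bool ({a, d} \<in> G)
         + of_bool ({b, c} \<in> G) + of_bool ({b, d} \<in> G) + of_bool ({c, d} \<in> G))
    + 6 * (of_bool ({a} \<in> G) + of_bool ({b} \<in> G) + of_bool ({c} \<in> G) + of_bool ({d} \<in> G))"
proof -
  have "{a, b, c, d} - {a} = {b, c, d}" "{a, b, c, d} - {b} = {a, c, d}"
    "{a, b, c, d} - {c} = {a, b, d}" "{a, b, c, d} - {d} = {a, b, c}"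
    using assms(2) by auto
  then show ?thesis
    using lubell_rec[of "{a, b, c, d}" G] assms lubell_triple[of G a b c]
      lubell_triple[of G a b d] lubell_triple[of G a c d] lubell_triple[of G b c d] by simp
qed

lemma capped_lubell_le:
  assumes "{} \<notin> G" and G: "contains_at_most_one G" and dist: "distinct [a, b, c, d]"
  shows "capped_lubell G {a, b, c, d} \<le> 5/4 - real_of_int (edge_form G a b c d) / 24"
proof -
  define su sp st :: int
    where "su = of_bool ({a} \<in> G) + of_bool ({b} \<in> G) + of_bool ({c} \<in> G) + of_bool ({d} \<in> G)"
      and "sp = of_bool ({a, b} \<in> G) + of_bool ({a, c} \<in> G) + of_bool ({a, d} \<in> G)
         + of_bool ({b, c} \<in> G) + of_bool ({b, d} \<in> G) + of_bool ({c, d} \<in> G)"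
      and "st = of_bool ({a, b, c} \<in> G) + of_bool ({a, b, d} \<in> G)
         + of_bool ({a, c, d} \<in> G) + of_bool ({b, c, d} \<in> G)"
  define h :: int where "h = of_bool ({a, b, c, d} \<in> G)"
  have one: "(\<Sum>E\<leftarrow>L. of_bool (E \<in> G)) \<le> (1::int)"
    if "D \<in> G" "distinct L" "\<forall>E\<in>set L. E \<subset> D" for D L
    using that G unfolding contains_at_most_one_def by (intro sum_list_of_bool_le_1) auto
  have pair: "{x, y} \<in> G \<longrightarrow> \<not> ({x} \<in> G \<and> {y} \<in> G)" if "x \<noteq> y" for x y
    using one[of "{x, y}" "[{x}, {y}]"] that by (auto simp: psubset_eq)
  have triple: "of_bool ({x, y, z} \<in> G)
      \<le> triple_room ({x} \<in> G) ({y} \<in> G) ({z} \<in> G) ({x, y} \<in> G) ({x, z} \<in> G) ({y, z} \<in> G)"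
    if "distinct [x, y, z]" for x y z
  proof (cases "{x, y, z} \<in> G")
    case True
    let ?L = "[{x}, {y}, {z}, {x, y}, {x, z}, {y, z}]"
    have "distinct ?L" "\<forall>E\<in>set ?L. E \<subset> {x, y, z}"
      using that by (auto simp: psubset_eq set_eq_subset)
    from one[OF True this] have "of_bool ({x} \<in> G) + of_bool ({y} \<in> G) + of_bool ({z} \<in> G)
        + of_bool ({x, y} \<in> G) + of_bool ({x, z} \<in> G) + of_bool ({y, z} \<in> G) \<le> (1::int)"
      by (simp only: list.map sum_list.Cons sum_list.Nil add_0_right add.assoc)
    then show ?thesis by (simp only: triple_room_def of_bool_eq) simp
  qed (simp add: triple_room_def)
  have "quad_ineq ({a} \<in> G) ({b} \<in> G) ({c} \<in> G) ({d} \<in> G) ({a, b} \<in> G) ({a, c} \<in> G) ({a, d} \<in> G)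
      ({b, c} \<in> G) ({b, d} \<in> G) ({c, d} \<in> G)"
    using dist by (intro quad_ineq_holds pair) auto
  moreover have "edge_form G a b c d = quad_form
     (red_pair ({a} \<in> G) ({b} \<in> G) ({a, b} \<in> G)) (red_pair ({a} \<in> G) ({c} \<in> G) ({a, c} \<in> G))
     (red_pair ({a} \<in> G) ({d} \<in> G) ({a, d} \<in> G)) (red_pair ({b} \<in> G) ({c} \<in> G) ({b, c} \<in> G))
     (red_pair ({b} \<in> G) ({d} \<in> G) ({b, d} \<in> G)) (red_pair ({c} \<in> G) ({d} \<in> G) ({c, d} \<in> G))"
    by (simp add: edge_form_def red_edge_def)
  moreover note triple[of a b c] triple[of a b d] triple[of a c d] triple[of b c d] dist
  ultimately have main: "6 * su + 4 * sp + 6 * st + edge_form G a b c d \<le> 30"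
    and small: "su + sp \<le> 1 \<longrightarrow> edge_form G a b c d \<le> sp"
    unfolding quad_ineq_def Let_def su_def sp_def st_def by simp_all
  have nonneg: "0 \<le> su" "0 \<le> sp" "0 \<le> st" by (simp_all add: su_def sp_def st_def)
  \<comment> \<open>All 14 nonempty proper subsets of the quadruple.\<close>
  let ?L = "[{a}, {b}, {c}, {d}, {a, b}, {a, c}, {a, d}, {b, c}, {b, d}, {c, d},
     {a, b, c}, {a, b, d}, {a, c, d}, {b, c, d}]"
  have dL: "distinct ?L" using dist by (auto simp: set_eq_subset)
  have sL: "(\<Sum>E\<leftarrow>?L. of_bool (E \<in> G)) = su + sp + st"
    by (simp add: su_def sp_def st_def)
  have "24 * lubell {a, b, c, d} G = real_of_int (6 * su + 4 * sp + 6 * st + 24 * h)"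
    by (simp add: lubell_quadruple[OF assms(1) dist] su_def sp_def st_def h_def)
  \<comment> \<open>If the quadruple is a member, then \<open>su + sp + st \<le> 1\<close> and the
    form is at most \<open>sp\<close>, so the terms other than \<open>24 * h\<close> add up to at
    most 6.\<close>
  moreover have "6 * su + 4 * sp + 6 * st + 24 * h + edge_form G a b c d \<le> 30"
  proof (cases "{a, b, c, d} \<in> G")
    case True
    have "\<forall>E\<in>set ?L. E \<subset> {a, b, c, d}" using dist by (auto simp: psubset_eq set_eq_subset)
    from one[OF True dL this] have "su + sp + st \<le> 1" unfolding sL .
    then show ?thesis using True nonneg small by (simp add: h_def)
  qed (use main in \<open>simp add: h_def\<close>)
  ultimately have "lubell {a, b, c, d} G \<le> 5/4 - real_of_int (edge_form G a b c d) / 24"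
    by linarith
  \<comment> \<open>With at most one member inside, the form is at most 1, and
    \<open>5/4 - 1/24 = 29/24\<close> still exceeds \<open>6/5\<close>.\<close>
  moreover have "6/5 \<le> 5/4 - real_of_int (edge_form G a b c d) / 24"
    if "\<not> (\<exists>D\<in>G. \<exists>E\<in>G. D \<noteq> E \<and> D \<subseteq> {a, b, c, d} \<and> E \<subseteq> {a, b, c, d})"
  proof -
    have "(\<Sum>E\<leftarrow>?L. of_bool (E \<in> G)) \<le> (1::int)"
    proof (rule sum_list_of_bool_le_1[OF dL])
      fix D E assume DE: "D \<in> set ?L \<inter> G" "E \<in> set ?L \<inter> G"
      have "\<forall>X\<in>set ?L. X \<subseteq> {a, b, c, d}" by simp
      with DE that show "D = E" by blast
    qed
    then have "edge_form G a b c d \<le> 1" using nonneg small unfolding sL by linarith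
    then have "real_of_int (edge_form G a b c d) \<le> 1" by simp
    then show ?thesis by simp
  qed
  ultimately show ?thesis unfolding capped_lubell_def by simp
qed

text \<open>There are \<open>N * (n - 3)\<close> quadruples and the forms sum to at least
  \<open>-6 * N\<close>, so subtracting their average over 24 costs at most
  \<open>1 / (4 * (n - 3))\<close>.\<close>

lemma lubell_le_of_contains_at_most_one:
  assumes "finite S" and "4 \<le> card S" and "{} \<notin> G" and "contains_at_most_one G"
  shows "lubell S G \<le> 5/4 + 1 / (4 * (real (card S) - 3))"
proof -
  let ?n = "real (card S)" and ?Q = "distinct_quads S"
  define N where "N = ?n * ((?n - 1) * (?n - 2))"
  have card: "real (card ?Q) = N * (?n - 3)"
    using assms(1,2) by (simp add: card_distinct_quads of_nat_diff N_def)
  have pos: "0 < N" using assms(2) by (simp add: N_def)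
  have "- int (card S * ((card S - 1) * (card S - 2)))
      \<le> (\<Sum>(a, b, c, d)\<in>?Q. edge_sign G a b c * edge_sign G a b d)"
    using assms(1,2) by (intro sum_sign_products_ge) auto
  then have "- 6 * int (card S * ((card S - 1) * (card S - 2))) \<le> (\<Sum>(a, b, c, d)\<in>?Q. edge_form G a b c d)"
    unfolding sum_edge_form by linarith
  then have "real_of_int (- 6 * int (card S * ((card S - 1) * (card S - 2))))
      \<le> real_of_int (\<Sum>(a, b, c, d)\<in>?Q. edge_form G a b c d)"
    by (rule of_int_le_iff[THEN iffD2])
  then have form: "- 6 * N \<le> (\<Sum>(a, b, c, d)\<in>?Q. real_of_int (edge_form G a b c d))"
    using assms(2) by (simp add: of_nat_diff split_def N_def)
  have "lubell S G * real (card ?Q) \<le> (\<Sum>(a, b, c, d)\<in>?Q. capped_lubell G {a, b, c, d})"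
    using assms by (rule lubell_le_average_capped)
  also have "\<dots> \<le> (\<Sum>(a, b, c, d)\<in>?Q. 5/4 - real_of_int (edge_form G a b c d) / 24)"
    using capped_lubell_le[OF assms(3,4)] by (intro sum_mono) (auto simp: distinct_quads_def)
  also have "\<dots> = 5/4 * real (card ?Q) - (\<Sum>(a, b, c, d)\<in>?Q. real_of_int (edge_form G a b c d)) / 24"
    by (simp add: split_def sum_subtractf sum_divide_distrib)
  also have "\<dots> \<le> 5/4 * real (card ?Q) + N / 4" using form by linarith
  finally have "lubell S G * (?n - 3) * N \<le> (5/4 * (?n - 3) + 1 / 4) * N"
    unfolding card by (simp add: field_simps)
  then have "lubell S G * (?n - 3) \<le> 5/4 * (?n - 3) + 1 / 4"
    using pos by (rule mult_right_le_imp_le)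
  then show ?thesis using assms(2) by (simp add: field_simps)
qed

section \<open>Diamond-free families\<close>

text \<open>Splitting chains by their largest member becomes an induction: while \<open>S\<close> is
  not a member, average over the sets \<open>S - {x}\<close>; once it is, it tops every chain and
  contributes 1. The size bound \<open>t\<close> keeps the error uniform over all such
  \<open>S\<close>.\<close>

lemma lubell_diamond_free_le:
  assumes "finite S" and F: "diamond_free F" and t: "4 \<le> t" "\<And>X. X \<in> F \<Longrightarrow> t \<le> card X"
  shows "lubell S F \<le> 9/4 + 1 / (4 * (real t - 3))"
  using assms(1)
proof (induction "card S" arbitrary: S rule: less_induct)
  case less
  let ?B = "9/4 + 1 / (4 * (real t - 3))"
  show ?case
  proof (cases "S \<in> F")
    case True
    define L where "L = {D \<in> F. D \<subset> S}"
    define G where "G = (\<lambda>D. S - D) ` L"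
    have "L \<subseteq> Pow S" and L: "{D \<in> L. D \<subseteq> S} = {D \<in> F. D \<subset> S}" by (auto simp: L_def)
    then have "lubell S G = lubell S L"
      unfolding G_def by (intro lubell_complement less.prems)
    then have "lubell S F = 1 + lubell S G"
      using True lubell_insert_self[OF less.prems, of F] by (simp add: lubell_def[of S L] L)
    moreover have "contains_at_most_one G"
      unfolding contains_at_most_one_def
    proof (intro ballI impI)
      fix D E E' assume "D \<in> G" "E \<in> G" "E' \<in> G" and sub: "E \<subset> D" "E' \<subset> D"
      then obtain A B C where ABC: "A \<in> L" "B \<in> L" "C \<in> L" "D = S - A" "E = S - B" "E' = S - C"
        by (auto simp: G_def)
      then have *: "A \<subset> B" "B \<subset> S" "A \<subset> C" "C \<subset> S" "A \<in> F" "B \<in> F" "C \<in> F"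
        using sub by (auto simp: L_def)
      \<comment> \<open>Two different members strictly between \<open>A\<close> and \<open>S\<close>
        would complete a diamond with top \<open>S\<close>.\<close>
      then have "distinct [A, B, C, S]" if "B \<noteq> C" using that by auto
      then have "B = C" using * F True unfolding diamond_free_def by blast
      then show "E = E'" using ABC by simp
    qed
    moreover have "{} \<notin> G" by (auto simp: G_def L_def)
    ultimately have "lubell S F \<le> 9/4 + 1 / (4 * (real (card S) - 3))"
      using lubell_le_of_contains_at_most_one[OF less.prems, of G] t(1) t(2)[OF True] by simp
    also have "\<dots> \<le> ?B" using t(1) t(2)[OF True] by (simp add: frac_le)
    finally show ?thesis .
  next
    case False
    show ?thesis
    proof (cases "S = {}")
      case True
      then have "lubell S F = 0" using False by (simp add: lubell_def)
      then show ?thesis using t(1) by simp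
    next
      case nonempty: False
      then have pos: "0 < real (card S)" using less.prems by (simp add: card_gt_0_iff)
      have "real (card S) * lubell S F = (\<Sum>x\<in>S. lubell (S - {x}) F)"
        using False by (simp add: lubell_rec[OF less.prems])
      also have "\<dots> \<le> (\<Sum>x\<in>S. ?B)"
        using less.prems by (intro sum_mono less.hyps) (use pos in auto)
      finally show ?thesis using pos by simp
    qed
  qed
qed

section \<open>From the Lubell function to cardinality\<close>

lemma card_le_lubell:
  assumes "finite S" and "F \<subseteq> Pow S"
  shows "real (card F) \<le> lubell S F * real (card S choose (card S div 2))"
proof -
  let ?C = "real (card S choose (card S div 2))"
  have C: "0 < ?C" by (simp add: zero_less_binomial_iff)
  have F: "{D \<in> F. D \<subseteq> S} = F" using assms(2) by auto
  have "(\<Sum>D\<in>F. 1 / ?C) \<le> (\<Sum>D\<in>F. 1 / real (card S choose card D))"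
  proof (rule sum_mono)
    fix D assume "D \<in> F"
    then have "card D \<le> card S" using assms by (auto intro: card_mono)
    then have "0 < card S choose card D" by (simp add: zero_less_binomial_iff)
    moreover have "card S choose card D \<le> card S choose (card S div 2)"
      by (rule binomial_maximum)
    ultimately show "1 / ?C \<le> 1 / real (card S choose card D)" by (intro frac_le) simp_all
  qed
  then have "real (card F) / ?C \<le> lubell S F"
    unfolding lubell_def F by simp
  then show ?thesis using C by (simp add: divide_le_eq)
qed

lemma card_small_subsets_le:
  assumes "finite V" and "0 < card V"
  shows "card {X. X \<subseteq> V \<and> card X < t} \<le> t * card V ^ t"
proof -
  have "{X. X \<subseteq> V \<and> card X < t} = (\<Union>j<t. {X. X \<subseteq> V \<and> card X = j})" by auto
  then have "card {X. X \<subseteq> V \<and> card X < t} \<le> (\<Sum>j<t. card {X. X \<subseteq> V \<and> card X = j})"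
    by (simp add: card_UN_le)
  also have "\<dots> = (\<Sum>j<t. card V choose j)" using n_subsets[OF assms(1)] by simp
  also have "\<dots> \<le> (\<Sum>j<t. card V ^ t)"
  proof (rule sum_mono)
    fix j assume "j \<in> {..<t}"
    then have "card V ^ j \<le> card V ^ t" using assms(2) by (intro power_increasing) auto
    moreover have "card V choose j \<le> card V ^ j"
      by (cases "j \<le> card V") (auto simp: binomial_le_pow binomial_eq_0)
    ultimately show "card V choose j \<le> card V ^ t" by linarith
  qed
  finally show ?thesis by simp
qed

lemma two_power_le_central_binomial: "2 ^ n \<le> (n + 1) * (n choose (n div 2))"
proof -
  have "2 ^ n = (\<Sum>k\<le>n. n choose k)" by (rule choose_row_sum[symmetric])
  also have "\<dots> \<le> (\<Sum>k\<le>n. n choose (n div 2))" by (intro sum_mono binomial_maximum)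
  finally show ?thesis by simp
qed

text \<open>The last summand accounts for the discarded small sets, at most \<open>t * n ^ t\<close>
  in number, measured against the central binomial coefficient, which is at least
  \<open>2 ^ n / (n + 1)\<close>. The threshold \<open>t\<close> stays free so that it can grow with
  \<open>n\<close>.\<close>

lemma card_diamond_free_le:
  assumes "finite V" and "0 < card V" and "F \<subseteq> Pow V" and "diamond_free F" and "4 \<le> t"
  shows "real (card F) \<le> (9/4 + 1 / (4 * (real t - 3))
      + real t * real (card V) ^ t * (real (card V) + 1) / 2 ^ card V)
    * real (card V choose (card V div 2))"
proof -
  let ?C = "real (card V choose (card V div 2))" and ?n = "real (card V)"
  define F1 where "F1 = {X \<in> F. t \<le> card X}"
  have fin: "finite {X. X \<subseteq> V \<and> card X < t}" using assms(1) by simp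
  have "finite F1" using assms(1,3) by (auto simp: F1_def intro: finite_subset[of _ "Pow V"])
  have "F \<subseteq> F1 \<union> {X. X \<subseteq> V \<and> card X < t}" using assms(3) by (auto simp: F1_def)
  then have "card F \<le> card (F1 \<union> {X. X \<subseteq> V \<and> card X < t})"
    using fin \<open>finite F1\<close> by (intro card_mono) auto
  also have "\<dots> \<le> card F1 + card {X. X \<subseteq> V \<and> card X < t}" by (rule card_Un_le)
  also have "\<dots> \<le> card F1 + t * card V ^ t" using card_small_subsets_le[OF assms(1,2)] by simp
  finally have "card F \<le> card F1 + t * card V ^ t" .
  then have 1: "real (card F) \<le> real (card F1) + real t * ?n ^ t"
    by (metis of_nat_le_iff of_nat_add of_nat_mult of_nat_power)
  have "diamond_free F1" using assms(4) unfolding diamond_free_def F1_def by blast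
  then have "lubell V F1 \<le> 9/4 + 1 / (4 * (real t - 3))"
    using assms(1,5) by (intro lubell_diamond_free_le) (auto simp: F1_def)
  then have "lubell V F1 * ?C \<le> (9/4 + 1 / (4 * (real t - 3))) * ?C"
    by (rule mult_right_mono) simp
  moreover have "real (card F1) \<le> lubell V F1 * ?C"
    using assms(1,3) by (intro card_le_lubell) (auto simp: F1_def)
  ultimately have 2: "real (card F1) \<le> (9/4 + 1 / (4 * (real t - 3))) * ?C" by linarith
  have "real (2 ^ card V) \<le> real ((card V + 1) * (card V choose (card V div 2)))"
    using two_power_le_central_binomial by (rule of_nat_mono)
  then have "1 \<le> (?n + 1) / 2 ^ card V * ?C" by (simp add: field_simps)
  then have "real t * ?n ^ t * 1 \<le> real t * ?n ^ t * ((?n + 1) / 2 ^ card V * ?C)"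
    by (intro mult_left_mono) auto
  with 1 2 show ?thesis by (simp add: algebra_simps)
qed

theorem theorem2:
  shows "\<exists>\<epsilon> :: nat \<Rightarrow> real. \<epsilon> \<longlonglongrightarrow> 0 \<and>
    (\<forall>n \<ge> 1. \<forall>F :: nat set set. F \<subseteq> Pow {1..n} \<longrightarrow> diamond_free F \<longrightarrow>
       real (card F) \<le> (2.25 + \<epsilon> n) * real (n choose (n div 2)))"
proof -
  \<comment> \<open>The threshold will be \<open>t = \<lfloor>sqrt n\<rfloor>\<close>: it tends to
    infinity, yet \<open>n powr sqrt n\<close> is negligible against \<open>2 ^ n\<close>. Bounding
    \<open>t\<close> by \<open>sqrt n - 1 < t \<le> sqrt n\<close> gives this expression.\<close>
  define \<delta> :: "nat \<Rightarrow> real" where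
    "\<delta> n = 1 / (4 * (sqrt n - 4)) + sqrt n * real n powr sqrt n * (real n + 1) / 2 ^ n" for n
  \<comment> \<open>From 25 on, \<open>sqrt n \<ge> 5\<close>, so \<open>sqrt n - 4\<close> is
    positive and \<open>t \<ge> 5\<close>. Below 25 the size of the power set suffices.\<close>
  define \<epsilon> :: "nat \<Rightarrow> real" where "\<epsilon> n = (if n < 25 then 2 ^ n else \<delta> n)" for n
  have "\<delta> \<longlonglongrightarrow> 0" unfolding \<delta>_def by real_asymp
  moreover have "\<forall>\<^sub>F n in sequentially. \<delta> n = \<epsilon> n"
    using eventually_ge_at_top[of 25] by eventually_elim (simp add: \<epsilon>_def)
  ultimately have "\<epsilon> \<longlonglongrightarrow> 0" by (rule Lim_transform_eventually)
  moreover have "real (card F) \<le> (2.25 + \<epsilon> n) * real (n choose (n div 2))"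
    if n: "1 \<le> n" and F: "F \<subseteq> Pow {1..n}" "diamond_free F" for n and F :: "nat set set"
  proof (cases "n < 25")
    case True
    have "card F \<le> card (Pow {1..n})" using F(1) by (intro card_mono) auto
    then have "real (card F) \<le> real (2 ^ n)" by (simp add: card_Pow del: of_nat_power)
    also have "\<dots> \<le> (2.25 + \<epsilon> n) * 1" using True by (simp add: \<epsilon>_def)
    also have "\<dots> \<le> (2.25 + \<epsilon> n) * real (n choose (n div 2))"
    proof (rule mult_left_mono)
      have "0 < n choose (n div 2)" by (simp add: zero_less_binomial_iff)
      then show "1 \<le> real (n choose (n div 2))" by linarith
    qed (use True in \<open>simp add: \<epsilon>_def\<close>)
    finally show ?thesis .
  next
    case False
    define t where "t = nat \<lfloor>sqrt n\<rfloor>"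
    have "sqrt 25 \<le> sqrt n" using False by (intro real_sqrt_le_mono) simp
    then have s: "5 \<le> sqrt n" by simp
    have t: "real t \<le> sqrt n" "sqrt n - 1 < real t" using s unfolding t_def by linarith+
    have "5 \<le> t" using s unfolding t_def by (simp add: le_nat_iff le_floor_iff)
    have "real n ^ t = real n powr t" using n by (simp add: powr_realpow)
    also have "\<dots> \<le> real n powr sqrt n" using n t(1) by (intro powr_mono) auto
    finally have "real t * real n ^ t * (real n + 1) / 2 ^ n
        \<le> sqrt n * real n powr sqrt n * (real n + 1) / 2 ^ n"
      using t(1) by (intro divide_right_mono mult_right_mono mult_mono) auto
    moreover have "1 / (4 * (real t - 3)) \<le> 1 / (4 * (sqrt n - 4))"
      using t(2) s by (intro frac_le) auto
    ultimately have "9/4 + 1 / (4 * (real t - 3)) + real t * real n ^ t * (real n + 1) / 2 ^ n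
        \<le> 2.25 + \<epsilon> n"
      using False by (simp add: \<epsilon>_def \<delta>_def)
    then have "(9/4 + 1 / (4 * (real t - 3)) + real t * real n ^ t * (real n + 1) / 2 ^ n)
        * real (n choose (n div 2)) \<le> (2.25 + \<epsilon> n) * real (n choose (n div 2))"
      by (rule mult_right_mono) simp
    moreover have "real (card F) \<le> (9/4 + 1 / (4 * (real t - 3))
        + real t * real n ^ t * (real n + 1) / 2 ^ n) * real (n choose (n div 2))"
      using card_diamond_free_le[of "{1..n}" F t] n F \<open>5 \<le> t\<close> by simp
    ultimately show ?thesis by linarith
  qed
  ultimately show ?thesis by blast
qed

end
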